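(* Let $\{\mathbf{x}^{k}\}_{k\ge 0}$ be the sequence generated by the CBCG method with the predefined stepsize $\alpha_i^k=\alpha^k=\frac{2}{k+2}$ for all $k\ge 0$ and $i=1,\dots,N$. Then, for any $k\ge 0$, $$H(\mathbf{x}^{k})-H^{\ast}\le \frac{2C_1}{k+1},$$ and, for any $n\ge 1$, $$\min_{k=\lfloor n/2\rfloor,\dots,n} S(\mathbf{x}^{k})\le \frac{8C_1}{n},$$ where $$C_1=\sum_{i=1}^{N}\beta_i\|\mathbf{A}_i\|^2D_i^2+2L_FD\|\mathbf{A}\|\sum_{i=1}^{N}D_i\|\mathbf{A}_i\|.$$
   Context: Setting. $\|\cdot\|$ is the Euclidean norm for vectors and the spectral norm for matrices. A vector $\mathbf{x}\in\mathbb{R}^{d}$ is partitioned into $N$ blocks $\mathbf{x}=(\mathbf{x}_1,\dots,\mathbf{x}_N)$, $\mathbf{x}_i\in\mathbb{R}^{n_i}$, $\sum_i n_i=d$; $\mathbf{U}_i\in\mathbb{R}^{d\times n_i}$ is the submatrix of the identity consisting of the columns of block $i$, so $\mathbf{x}_i=\mathbf{U}_i^T\mathbf{x}$ and $\mathbf{x}=\sum_i\mathbf{U}_i\mathbf{x}_i$. Let $\mathbf{A}\in\mathbb{R}^{m\times d}$ and $\mathbf{A}_i=\mathbf{A}\mathbf{U}_i$. Assumptions: (1) each $g_i:\mathbb{R}^{n_i}\to(-\infty,\infty]$ is proper, closed and convex, its domain $X_i=\mathrm{dom}\,g_i$ is compact with diameter $D_i$, and $g_i$ is Lipschitz on $X_i$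 with constant $l_i$. Put $X=X_1\times\cdots\times X_N$, with diameter $D$, $D^2=\sum_i D_i^2$. (2) $F:\mathbb{R}^m\to\mathbb{R}$ is convex and continuously differentiable over $\mathbf{A}(X)$ (i.e. continuously differentiable on an open set containing it), and $\nabla F$ is Lipschitz on $\mathbf{A}(X)$ with constant $L_F$. (3) For each $i$ there is a constant $\beta_i>0$ with $\|\nabla F(\mathbf{A}\mathbf{x}+\mathbf{A}_i\mathbf{h}_i)-\nabla F(\mathbf{A}\mathbf{x})\|\le\beta_i\|\mathbf{A}_i\mathbf{h}_i\|$ for all $\mathbf{x}\in X$, $\mathbf{h}_i\in\mathbb{R}^{n_i}$ with $\mathbf{x}+\mathbf{U}_i\mathbf{h}_i\in X$. Notation: $f(\mathbf{x})=F(\mathbf{A}\mathbf{x})$, $g(\mathbf{x})=\sum_i g_i(\mathbf{x}_i)$, $H=f+g$, $\nabla_i f(\mathbf{x})=\mathbf{U}_i^T\nabla f(\mathbf{x})=\mathbf{A}_i^T\nabla F(\mathbf{A}\mathbf{x})$, $H^{\ast}=\min H$ (attained). Optimality measure: for $\mathbf{x}\in X$, $S(\mathbf{x})=\max_{\mathbf{p}\in X}\{\langle\nabla f(\mathbf{x}),\mathbf{x}-\mathbf{p}\rangle+g(\mathbf{x})-g(\mathbf{p})\}$. CBCG (Cyclic Block Conditional Gradient) method: start from any $\mathbf{x}^0\in X$. For $k=0,1,2,\dots$: set $\mathbf{x}^{k,0}=\mathbf{x}^k$; for $i=1,\dots,N$ in order, choose $\mathbf{p}_i^k\in\mathrm{argmin}_{\mathbf{p}_i\in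 X_i}\{\langle\nabla_i f(\mathbf{x}^{k,i-1}),\mathbf{p}_i\rangle+g_i(\mathbf{p}_i)\}$ and set $\mathbf{x}^{k,i}=\mathbf{x}^{k,i-1}+\alpha_i^k\mathbf{U}_i(\mathbf{p}_i^k-\mathbf{x}_i^{k,i-1})$; then set $\mathbf{x}^{k+1}=\mathbf{x}^{k,N}$.
   Formalization: The bound on H(x^k) − H* is stated for k ≥ 1 instead of k ≥ 0: for k = 0 it is false (A = 0, F = 0, g_1 = |·| on [−1,1], x^0 = 1 gives C_1 = 0 but H(x^0) − H* = 1). *)

theory Defs
  imports "HOL-Analysis.Analysis"
begin

text \<open>
  Block structure.  A partition of the coordinates of \<open>real ^ 'd\<close> into \<open>N\<close> nonempty blocks is a
  labelling \<open>b :: 'd \<Rightarrow> nat\<close> with \<open>range b = {1..N}\<close>.  The dimensions of the blocks cannot be types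
  here, because they vary with the block; the space of the \<open>i\<close>-th block is therefore realised as the
  subspace \<open>blk_space b i\<close> of vectors supported on block \<open>i\<close>, with the inherited Euclidean
  structure, and \<open>blk_U b i\<close> is the submatrix of the identity formed by the columns of block \<open>i\<close>,
  padded by zero columns at the positions outside the block (the padding changes neither products with
  block vectors nor spectral norms).
\<close>

definition blk_space :: "('d::finite \<Rightarrow> nat) \<Rightarrow> nat \<Rightarrow> (real ^ 'd) set" where
  "blk_space b i = {x. \<forall>j. b j \<noteq> i \<longrightarrow> x $ j = 0}"

definition blk_U :: "('d::finite \<Rightarrow> nat) \<Rightarrow> nat \<Rightarrow> real ^ 'd ^ 'd" where
  "blk_U b i = (\<chi> r c. if r = c \<and> b c = i then 1 else 0)"

definition spectral_norm :: "real ^ 'n ^ 'm \<Rightarrow> real" where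
  "spectral_norm A = onorm (\<lambda>x. A *v x)"


text \<open>
  Extended-valued functions on a linear subspace \<open>V\<close>; values outside \<open>V\<close> are irrelevant.
\<close>

definition eff_dom :: "'a set \<Rightarrow> ('a \<Rightarrow> ereal) \<Rightarrow> 'a set" where
  "eff_dom V h = {x \<in> V. h x < \<infinity>}"

definition ereal_epigraph :: "'a set \<Rightarrow> ('a \<Rightarrow> ereal) \<Rightarrow> ('a \<times> real) set" where
  "ereal_epigraph V h = {(x, t). x \<in> V \<and> h x \<le> ereal t}"

definition proper_fun :: "'a set \<Rightarrow> ('a \<Rightarrow> ereal) \<Rightarrow> bool" where
  "proper_fun V h \<longleftrightarrow> (\<forall>x\<in>V. h x \<noteq> -\<infinity>) \<and> eff_dom V h \<noteq> {}"

definition closed_fun :: "'a::topological_space set \<Rightarrow> ('a \<Rightarrow> ereal) \<Rightarrow> bool" where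
  "closed_fun V h \<longleftrightarrow> closed (ereal_epigraph V h)"

definition convex_fun :: "'a::real_vector set \<Rightarrow> ('a \<Rightarrow> ereal) \<Rightarrow> bool" where
  "convex_fun V h \<longleftrightarrow> convex (ereal_epigraph V h)"


definition grad :: "('a::real_inner \<Rightarrow> real) \<Rightarrow> 'a \<Rightarrow> 'a" where
  "grad \<phi> x = (THE D. GDERIV \<phi> x :> D)"

definition C1_over :: "('a::real_inner \<Rightarrow> real) \<Rightarrow> 'a set \<Rightarrow> bool" where
  "C1_over \<phi> Y \<longleftrightarrow> (\<exists>W. open W \<and> Y \<subseteq> W \<and>
     (\<forall>y\<in>W. \<exists>D. GDERIV \<phi> y :> D) \<and> continuous_on W (grad \<phi>))"


definition blk_dom :: "('d::finite \<Rightarrow> nat) \<Rightarrow> (nat \<Rightarrow> real ^ 'd \<Rightarrow> ereal) \<Rightarrow> nat \<Rightarrow> (real ^ 'd) set" where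
  "blk_dom b g i = eff_dom (blk_space b i) (g i)"

definition prod_dom :: "('d::finite \<Rightarrow> nat) \<Rightarrow> nat \<Rightarrow> (nat \<Rightarrow> real ^ 'd \<Rightarrow> ereal) \<Rightarrow> (real ^ 'd) set" where
  "prod_dom b N g = {x. \<forall>i\<in>{1..N}. transpose (blk_U b i) *v x \<in> blk_dom b g i}"

definition f_obj :: "real ^ 'd ^ 'm \<Rightarrow> (real ^ 'm \<Rightarrow> real) \<Rightarrow> real ^ 'd \<Rightarrow> real" where
  "f_obj A F x = F (A *v x)"

definition g_obj :: "('d::finite \<Rightarrow> nat) \<Rightarrow> nat \<Rightarrow> (nat \<Rightarrow> real ^ 'd \<Rightarrow> ereal) \<Rightarrow> real ^ 'd \<Rightarrow> ereal" where
  "g_obj b N g x = (\<Sum>i=1..N. g i (transpose (blk_U b i) *v x))"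

definition H_obj ::
  "('d::finite \<Rightarrow> nat) \<Rightarrow> nat \<Rightarrow> real ^ 'd ^ 'm \<Rightarrow> (real ^ 'm \<Rightarrow> real) \<Rightarrow> (nat \<Rightarrow> real ^ 'd \<Rightarrow> ereal)
   \<Rightarrow> real ^ 'd \<Rightarrow> ereal" where
  "H_obj b N A F g x = ereal (f_obj A F x) + g_obj b N g x"

text \<open>
  \<open>LEAST\<close> and \<open>GREATEST\<close> denote a true minimum and a true maximum: the values are unspecified unless
  the extremum is attained.
\<close>

definition H_min ::
  "('d::finite \<Rightarrow> nat) \<Rightarrow> nat \<Rightarrow> real ^ 'd ^ 'm \<Rightarrow> (real ^ 'm \<Rightarrow> real) \<Rightarrow> (nat \<Rightarrow> real ^ 'd \<Rightarrow> ereal)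
   \<Rightarrow> ereal" where
  "H_min b N A F g = (LEAST v. v \<in> range (H_obj b N A F g))"

definition S_meas ::
  "('d::finite \<Rightarrow> nat) \<Rightarrow> nat \<Rightarrow> real ^ 'd ^ 'm \<Rightarrow> (real ^ 'm \<Rightarrow> real) \<Rightarrow> (nat \<Rightarrow> real ^ 'd \<Rightarrow> ereal)
   \<Rightarrow> real ^ 'd \<Rightarrow> ereal" where
  "S_meas b N A F g x =
     (GREATEST v. \<exists>p\<in>prod_dom b N g.
        v = ereal (grad (f_obj A F) x \<bullet> (x - p)) + g_obj b N g x - g_obj b N g p)"

definition grad_blk ::
  "('d::finite \<Rightarrow> nat) \<Rightarrow> real ^ 'd ^ 'm \<Rightarrow> (real ^ 'm \<Rightarrow> real) \<Rightarrow> nat \<Rightarrow> real ^ 'd \<Rightarrow> real ^ 'd" where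
  "grad_blk b A F i x = transpose (blk_U b i) *v grad (f_obj A F) x"

text \<open>
  \<open>x k\<close> are the outer iterates, \<open>y k i\<close> the inner iterates (\<open>i = 0, \<dots>, N\<close>), \<open>p k i\<close> the chosen
  minimisers and \<open>\<alpha> k i\<close> the stepsizes.
\<close>

definition CBCG ::
  "('d::finite \<Rightarrow> nat) \<Rightarrow> nat \<Rightarrow> real ^ 'd ^ 'm \<Rightarrow> (real ^ 'm \<Rightarrow> real) \<Rightarrow> (nat \<Rightarrow> real ^ 'd \<Rightarrow> ereal)
   \<Rightarrow> (nat \<Rightarrow> nat \<Rightarrow> real) \<Rightarrow> (nat \<Rightarrow> real ^ 'd) \<Rightarrow> (nat \<Rightarrow> nat \<Rightarrow> real ^ 'd) \<Rightarrow> (nat \<Rightarrow> nat \<Rightarrow> real ^ 'd)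
   \<Rightarrow> bool" where
  "CBCG b N A F g \<alpha> x y p \<longleftrightarrow>
     x 0 \<in> prod_dom b N g \<and>
     (\<forall>k. y k 0 = x k \<and>
       (\<forall>i\<in>{1..N}.
          is_arg_min (\<lambda>q. ereal (grad_blk b A F i (y k (i - 1)) \<bullet> q) + g i q)
                     (\<lambda>q. q \<in> blk_dom b g i) (p k i) \<and>
          y k i = y k (i - 1) +
            \<alpha> k i *\<^sub>R (blk_U b i *v (p k i - transpose (blk_U b i) *v y k (i - 1)))) \<and>
       x (Suc k) = y k N)"

definition C1_const ::
  "('d::finite \<Rightarrow> nat) \<Rightarrow> nat \<Rightarrow> real ^ 'd ^ 'm \<Rightarrow> (nat \<Rightarrow> real ^ 'd \<Rightarrow> ereal) \<Rightarrow> real \<Rightarrow> (nat \<Rightarrow> real)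
   \<Rightarrow> real" where
  "C1_const b N A g LF \<beta> =
     (\<Sum>i=1..N. \<beta> i * (spectral_norm (A ** blk_U b i))\<^sup>2 * (diameter (blk_dom b g i))\<^sup>2)
     + 2 * LF * diameter (prod_dom b N g) * spectral_norm A *
       (\<Sum>i=1..N. diameter (blk_dom b g i) * spectral_norm (A ** blk_U b i))"

end

theory Submission
  imports Defs
begin

text \<open>
  On block \<open>i\<close> the descent lemma with constant \<open>\<beta> i\<close>, convexity of \<open>g i\<close> and the choice of \<open>p k i\<close>
  bound the decrease of \<open>H\<close> by the block gap at the inner iterate.  Replacing the gradient at the
  inner iterate by the gradient at \<open>x k\<close> costs another second-order term, because the inner iterate
  is within \<open>\<alpha> D\<close> of \<open>x k\<close>.  Summing over the blocks gives
  \<open>H (x (k + 1)) \<le> H (x k) - \<alpha> S (x k) + \<alpha>\<^sup>2 C1 / 2\<close>.  Since \<open>S\<close> dominates the optimality gap by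
  convexity, induction yields the rate of \<open>H\<close>; summing the inequality from \<open>n div 2\<close> to \<open>n\<close>, where
  the stepsizes add up to at least 1, yields the rate of \<open>S\<close>.
\<close>

subsection \<open>Rates from the one-step recursion\<close>

text \<open>Bounding \<open>S k\<close> below by \<open>\<delta> k\<close> turns the recursion into
  weight \<open>1 - a\<close> on \<open>\<delta> k\<close> plus a term of order
  \<open>a\<^sup>2\<close>, the classical Frank-Wolfe induction. It starts at 1: the first stepsize
  is 1, so \<open>\<delta> 0\<close> cancels, whereas \<open>\<delta> 0\<close> itself is not
  controlled by \<open>C\<close>.\<close>

lemma fw_rate_gap:
  fixes \<delta> S :: "nat \<Rightarrow> real"
  assumes step: "\<And>k. \<delta> (Suc k) \<le> \<delta> k - 2 / (real k + 2) * S k + (2 / (real k + 2))\<^sup>2 * (C / 2)"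
    and gap: "\<And>k. \<delta> k \<le> S k" and C: "C \<ge> 0" and k: "k \<ge> 1"
  shows "\<delta> k \<le> 2 * C / (real k + 1)"
  using k
proof (induction k rule: nat_induct_at_least)
  case base
  show ?case
    using step[of 0] gap[of 0] C by (simp add: power2_eq_square)
next
  case (Suc k)
  define a where "a = 2 / (real k + 2)"
  have a: "0 \<le> a" "a \<le> 1"
    by (auto simp: a_def)
  have "\<delta> (Suc k) \<le> \<delta> k - a * S k + a\<^sup>2 * (C / 2)"
    using step[of k] by (simp add: a_def)
  also have "\<dots> \<le> (1 - a) * \<delta> k + a\<^sup>2 * (C / 2)"
    using mult_left_mono[OF gap[of k] a(1)] by (simp add: algebra_simps)
  also have "\<dots> \<le> (1 - a) * (2 * C / (real k + 1)) + a\<^sup>2 * (C / 2)"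
    using mult_left_mono[OF Suc.IH, of "1 - a"] a by simp
  \<comment> \<open>Since \<open>1 - a = k / (k + 2)\<close>, the target
    \<open>2 * C / (k + 2)\<close> factors out and only a bracket is left to compare with 1.\<close>
  also have "\<dots> = 2 * C / (real k + 2) * (real k / (real k + 1) + 1 / (real k + 2))"
    by (simp add: a_def divide_simps power2_eq_square) (simp add: algebra_simps)
  also have "\<dots> \<le> 2 * C / (real k + 2) * 1"
  proof (rule mult_left_mono)
    have "1 / (real k + 2) \<le> 1 / (real k + 1)"
      by (simp add: divide_simps)
    moreover have "real k / (real k + 1) + 1 / (real k + 1) = 1"
      by (simp add: divide_simps)
    ultimately show "real k / (real k + 1) + 1 / (real k + 2) \<le> 1"
      by linarith
  qed (use C in simp)
  finally show ?case
    by (simp add: add.commute)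
qed

text \<open>Telescoping: the inverse square of \<open>k + 2\<close> is at most
  \<open>1 / ((k + 1) * (k + 2))\<close>, which is \<open>1 / (k + 1) - 1 / (k + 2)\<close>.\<close>

lemma sum_inverse_squares_le:
  assumes "m \<le> n"
  shows "(\<Sum>k=m..n. (2 / (real k + 2))\<^sup>2) \<le> 4 * (1 / (real m + 1) - 1 / (real n + 2))"
  using assms
proof (induction n rule: dec_induct)
  case base
  show ?case
    by (simp add: divide_simps power2_eq_square)
next
  case (step n)
  have "(2 / (real (Suc n) + 2))\<^sup>2 \<le> 4 * (1 / (real n + 2) - 1 / (real (Suc n) + 2))"
    by (simp add: divide_simps power2_eq_square)
  then show ?case
    using step by (simp add: algebra_simps)
qed

text \<open>By contradiction: were every gap in the window above \<open>8 * C / n\<close>, the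
  summed recursion would force a larger decrease than is available. Starting at
  \<open>n div 2\<close> leaves enough stepsizes to reach total 1, while \<open>\<delta>\<close> at
  the start is already of order \<open>C / n\<close>.\<close>

lemma fw_rate_min_gap:
  fixes \<delta> S :: "nat \<Rightarrow> real"
  assumes step: "\<And>k. \<delta> (Suc k) \<le> \<delta> k - 2 / (real k + 2) * S k + (2 / (real k + 2))\<^sup>2 * (C / 2)"
    and gap: "\<And>k. \<delta> k \<le> S k" and nonneg: "\<And>k. 0 \<le> \<delta> k" and C: "C \<ge> 0" and n: "n \<ge> 1"
  shows "\<exists>k\<in>{n div 2..n}. S k \<le> 8 * C / real n"
proof (cases "n = 1")
  \<comment> \<open>Here \<open>n div 2 = 0\<close>, and no bound on \<open>\<delta> 0\<close> is available; the index 1 works.\<close>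
  case True
  have "S 1 \<le> 8 * C"
    using step[of 1] nonneg[of 2] fw_rate_gap[of \<delta> S C 1] step gap C
    by (simp add: power2_eq_square numeral_2_eq_2)
  then show ?thesis
    using True by auto
next
  case False
  define m where "m = n div 2"
  have m: "m \<ge> 1" "m \<le> n"
    using n False by (auto simp: m_def)
  define a where "a k = 2 / (real k + 2)" for k :: nat
  define t where "t = 8 * C / real n"
  have t: "t \<ge> 0"
    using C by (simp add: t_def)
  show ?thesis
  proof (rule ccontr)
    assume "\<not> ?thesis"
    then have big: "S k > t" if "k \<in> {m..n}" for k
      using that by (force simp: m_def t_def)
    have tele: "(\<Sum>k=m..n. a k * S k) \<le> \<delta> m - \<delta> (Suc n) + C / 2 * (\<Sum>k=m..n. (a k)\<^sup>2)"
    proof -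
      have "(\<Sum>k=m..n. a k * S k) \<le> (\<Sum>k=m..n. (\<delta> k - \<delta> (Suc k)) + C / 2 * (a k)\<^sup>2)"
        by (rule sum_mono) (use step in \<open>auto simp: a_def algebra_simps\<close>)
      also have "\<dots> = \<delta> m - \<delta> (Suc n) + C / 2 * (\<Sum>k=m..n. (a k)\<^sup>2)"
        using m sum_Suc_diff'[of m "Suc n" "\<lambda>k. - \<delta> k"]
        by (simp add: sum.distrib sum_distrib_left atLeastLessThanSuc_atLeastAtMost)
      finally show ?thesis .
    qed
    have "1 \<le> (\<Sum>k=m..n. a k)"
    proof -
      \<comment> \<open>The window has \<open>n + 1 - m\<close> indices, at least
        \<open>(n + 2) / 2\<close> because \<open>2 * m \<le> n\<close>, and each stepsize in it is
        at least \<open>2 / (n + 2)\<close>.\<close>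
      have "n + 2 \<le> 2 * (Suc n - m)"
        by (auto simp: m_def)
      then have "real n + 2 \<le> real (Suc n - m) * 2"
        by linarith
      then have "1 \<le> real (Suc n - m) * (2 / (real n + 2))"
        by (simp add: divide_simps)
      also have "\<dots> = (\<Sum>k=m..n. 2 / (real n + 2))"
        by simp
      also have "\<dots> \<le> (\<Sum>k=m..n. a k)"
        unfolding a_def by (intro sum_mono divide_left_mono) auto
      finally show ?thesis .
    qed
    then have "t \<le> (\<Sum>k=m..n. a k) * t"
      using mult_right_mono t by fastforce
    also have "\<dots> = (\<Sum>k=m..n. a k * t)"
      by (rule sum_distrib_right)
    also have "\<dots> < (\<Sum>k=m..n. a k * S k)"
      by (rule sum_strict_mono) (use m big in \<open>auto simp: a_def intro!: mult_strict_left_mono divide_strict_right_mono\<close>)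
    also have "\<dots> \<le> \<delta> m - \<delta> (Suc n) + C / 2 * (\<Sum>k=m..n. (a k)\<^sup>2)"
      by (rule tele)
    \<comment> \<open>Both summands equal \<open>2 * C / (m + 1)\<close>: one is the rate at
      \<open>m\<close>, which needs \<open>m \<ge> 1\<close>, the other comes from the squared
      stepsizes. The term \<open>\<delta> (Suc n)\<close> is dropped by nonnegativity.\<close>
    also have "\<dots> \<le> 2 * C / (real m + 1) + C / 2 * (4 * (1 / (real m + 1)))"
    proof -
      have "(\<Sum>k=m..n. (a k)\<^sup>2) \<le> 4 * (1 / (real m + 1))"
        using sum_inverse_squares_le[OF m(2)] unfolding a_def
        by (smt (verit, best) divide_nonneg_nonneg of_nat_0_le_iff)
      then have "C / 2 * (\<Sum>k=m..n. (a k)\<^sup>2) \<le> C / 2 * (4 * (1 / (real m + 1)))"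
        by (rule mult_left_mono) (use C in simp)
      then show ?thesis
        using fw_rate_gap[of \<delta> S C m] step gap C m nonneg[of "Suc n"] by fastforce
    qed
    also have "\<dots> = 8 * C / (2 * (real m + 1))"
      by (simp add: divide_simps)
    also have "\<dots> \<le> t"
    proof -
      have "n \<le> 2 * m + 2"
        by (auto simp: m_def)
      then have "real n \<le> real (2 * m + 2)"
        by (simp only: of_nat_le_iff)
      then have "real n \<le> 2 * (real m + 1)"
        by simp
      then show ?thesis
        unfolding t_def using C n by (intro divide_left_mono) auto
    qed
    finally show False
      by simp
  qed
qed

subsection \<open>Gradients\<close>

lemma grad_eq:
  assumes "GDERIV \<phi> x :> D"
  shows "grad \<phi> x = D"
  unfolding grad_def
proof (rule the_equality)
  fix E assume "GDERIV \<phi> x :> E"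
  then have "(\<lambda>h. h \<bullet> E) = (\<lambda>h. h \<bullet> D)"
    using assms unfolding gderiv_def by (rule has_derivative_unique)
  \<comment> \<open>The two derivatives agree on every increment; the increment \<open>E - D\<close>
    produces its own squared norm.\<close>
  then have "(E - D) \<bullet> E = (E - D) \<bullet> D"
    by (rule fun_cong)
  then have "(E - D) \<bullet> (E - D) = 0"
    by (simp add: inner_diff_right)
  then show "E = D"
    by simp
qed (rule assms)

lemma GDERIV_line:
  assumes "GDERIV F (u + t *\<^sub>R v) :> D"
  shows "((\<lambda>t. F (u + t *\<^sub>R v)) has_real_derivative v \<bullet> D) (at t)"
proof -
  have "(F has_derivative (\<lambda>h. h \<bullet> D)) (at (u + t *\<^sub>R v))"
    using assms by (simp add: gderiv_def)
  moreover have "((\<lambda>t. u + t *\<^sub>R v) has_derivative (\<lambda>s. s *\<^sub>R v)) (at t)"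
    by (auto intro!: derivative_eq_intros)
  ultimately have "((\<lambda>t. F (u + t *\<^sub>R v)) has_derivative (\<lambda>s. s *\<^sub>R v \<bullet> D)) (at t)"
    by (rule has_derivative_compose[rotated])
  then show ?thesis
    by (simp add: has_field_derivative_def mult.commute[of _ "v \<bullet> D"])
qed

lemma GDERIV_matrix_compose:
  fixes A :: "real ^ 'd ^ 'm"
  assumes "GDERIV F (A *v z) :> D"
  shows "GDERIV (\<lambda>z. F (A *v z)) z :> transpose A *v D"
proof -
  have "((\<lambda>z. A *v z) has_derivative (\<lambda>h. A *v h)) (at z)"
    by (rule bounded_linear_imp_has_derivative) simp
  then have "((\<lambda>z. F (A *v z)) has_derivative (\<lambda>h. (A *v h) \<bullet> D)) (at z)"
    using assms unfolding gderiv_def by (rule has_derivative_compose)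
  moreover have "(A *v h) \<bullet> D = h \<bullet> (transpose A *v D)" for h
    by (metis dot_lmul_matrix inner_commute transpose_matrix_vector)
  ultimately show ?thesis
    by (simp add: gderiv_def)
qed

text \<open>The gradient is compared only with its value at the start of the segment, so an estimate
  in one direction suffices; this is exactly what a block constant \<open>\<beta> i\<close>
  provides.\<close>

lemma descent_along_segment:
  assumes deriv: "\<And>t. 0 \<le> t \<Longrightarrow> t \<le> 1 \<Longrightarrow> GDERIV F (u + t *\<^sub>R v) :> G t"
    and lip: "\<And>t. 0 \<le> t \<Longrightarrow> t \<le> 1 \<Longrightarrow> norm (G t - G 0) \<le> M * (t * norm v)"
  shows "F (u + v) \<le> F u + v \<bullet> G 0 + M / 2 * (norm v)\<^sup>2"
proof -
  \<comment> \<open>\<open>\<psi>\<close> is \<open>F\<close> along the segment minus the linear and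
    quadratic terms of the bound. Cauchy-Schwarz makes its derivative nonpositive, and comparing its
    values at 1 and 0 is the claim.\<close>
  define \<psi> where "\<psi> t = F (u + t *\<^sub>R v) - t * (v \<bullet> G 0) - M / 2 * (norm v)\<^sup>2 * t\<^sup>2" for t
  have "\<psi> 1 \<le> \<psi> 0"
  proof (rule DERIV_nonpos_imp_nonincreasing[of 0 1])
    fix t :: real assume t: "0 \<le> t" "t \<le> 1"
    have "(\<psi> has_real_derivative v \<bullet> G t - v \<bullet> G 0 - M * (norm v)\<^sup>2 * t) (at t)"
      unfolding \<psi>_def by (rule derivative_eq_intros GDERIV_line[OF deriv[OF t]] refl | simp)+
    moreover have "v \<bullet> G t - v \<bullet> G 0 \<le> M * (norm v)\<^sup>2 * t"
    proof -
      have "v \<bullet> G t - v \<bullet> G 0 \<le> norm v * norm (G t - G 0)"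
        by (metis inner_diff_right norm_cauchy_schwarz)
      also have "\<dots> \<le> norm v * (M * (t * norm v))"
        using lip[OF t] by (intro mult_left_mono) auto
      finally show ?thesis
        by (simp add: power2_eq_square mult_ac)
    qed
    ultimately show "\<exists>D. (\<psi> has_real_derivative D) (at t) \<and> D \<le> 0"
      by auto
  qed simp
  then show ?thesis
    by (simp add: \<psi>_def)
qed

text \<open>Convexity bounds the difference quotients at \<open>u\<close> by
  \<open>F w - F u\<close>, and the bound passes to the limit. The limit is taken from the right,
  since for negative \<open>t\<close> the point may leave \<open>Y\<close>.\<close>

lemma convex_on_above_tangent:
  assumes F: "convex_on Y F" and u: "u \<in> Y" and w: "w \<in> Y" and deriv: "GDERIV F u :> D"
  shows "F u + (w - u) \<bullet> D \<le> F w"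
proof -
  have "((\<lambda>t. F (u + t *\<^sub>R (w - u))) has_real_derivative (w - u) \<bullet> D) (at 0)"
    using deriv by (intro GDERIV_line) simp
  then have "((\<lambda>t. (F (u + t *\<^sub>R (w - u)) - F u) / t) \<longlongrightarrow> (w - u) \<bullet> D) (at 0)"
    by (simp add: DERIV_def)
  then have "((\<lambda>t. (F (u + t *\<^sub>R (w - u)) - F u) / t) \<longlongrightarrow> (w - u) \<bullet> D) (at_right 0)"
    by (rule filterlim_at_split[THEN iffD1, THEN conjunct2])
  moreover have "\<forall>\<^sub>F t in at_right 0. (F (u + t *\<^sub>R (w - u)) - F u) / t \<le> F w - F u"
  proof (rule eventually_at_rightI)
    fix t :: real assume t: "t \<in> {0<..<1}"
    have "F (u + t *\<^sub>R (w - u)) = F ((1 - t) *\<^sub>R u + t *\<^sub>R w)"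
      by (simp add: algebra_simps)
    also have "\<dots> \<le> (1 - t) * F u + t * F w"
      using t by (intro convex_onD[OF F]) (use u w in auto)
    finally show "(F (u + t *\<^sub>R (w - u)) - F u) / t \<le> F w - F u"
      using t by (simp add: divide_simps algebra_simps)
  qed simp
  ultimately have "(w - u) \<bullet> D \<le> F w - F u"
    by (rule tendsto_upperbound) simp
  then show ?thesis
    by simp
qed

subsection \<open>Block projections\<close>

text \<open>With blocks embedded as subspaces, the padded \<open>blk_U b i\<close> is a symmetric
  projection matrix. This is its action; it serves both for extracting a block and for embedding
  it.\<close>

definition blk_proj :: "('d::finite \<Rightarrow> nat) \<Rightarrow> nat \<Rightarrow> real ^ 'd \<Rightarrow> real ^ 'd" where
  "blk_proj b i z = (\<chi> j. if b j = i then z $ j else 0)"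

lemma blk_U_mult: "blk_U b i *v z = blk_proj b i z"
proof -
  have "(blk_U b i *v z) $ j = (\<Sum>c\<in>UNIV. if j = c then blk_proj b i z $ c else 0)" for j
    unfolding matrix_vector_mult_def vec_lambda_beta
    by (rule sum.cong) (auto simp: blk_U_def blk_proj_def)
  then show ?thesis
    by (simp add: vec_eq_iff)
qed

lemma transpose_blk_U: "transpose (blk_U b i) = blk_U b i"
  by (auto simp: transpose_def blk_U_def vec_eq_iff)

lemma linear_blk_proj: "linear (blk_proj b i)"
  using matrix_vector_mul_linear[of "blk_U b i"] by (simp add: blk_U_mult)

lemmas blk_proj_add = linear_add[OF linear_blk_proj]
  and blk_proj_diff = linear_diff[OF linear_blk_proj]
  and blk_proj_scaleR = linear_scale[OF linear_blk_proj]
  and blk_proj_sum = linear_sum[OF linear_blk_proj]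

lemma blk_proj_blk_proj: "blk_proj b i (blk_proj b j z) = (if i = j then blk_proj b i z else 0)"
  by (auto simp: blk_proj_def vec_eq_iff)

lemma blk_proj_in_blk_space [simp]: "blk_proj b i z \<in> blk_space b i"
  by (simp add: blk_proj_def blk_space_def)

lemma blk_proj_of_blk_space:
  assumes "z \<in> blk_space b j"
  shows "blk_proj b i z = (if i = j then z else 0)"
  using assms by (auto simp: blk_proj_def blk_space_def vec_eq_iff)

text \<open>Moves the projection contained in \<open>grad_blk\<close> onto the other factor, where
  it fixes block vectors.\<close>

lemma blk_proj_inner: "blk_proj b i z \<bullet> w = z \<bullet> blk_proj b i w"
  by (simp add: inner_vec_def blk_proj_def if_distrib[of "\<lambda>c. c * _"] if_distrib[of "\<lambda>c. _ * c"]
      cong: if_cong)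

lemma sum_blk_proj:
  assumes "range b \<subseteq> I" and "finite I"
  shows "(\<Sum>i\<in>I. blk_proj b i z) = z"
proof -
  have "b j \<in> I" for j
    using assms by auto
  then show ?thesis
    using assms(2) by (simp add: vec_eq_iff blk_proj_def)
qed

lemma spectral_norm_bound: "norm (A *v z) \<le> spectral_norm A * norm z"
  unfolding spectral_norm_def by (rule onorm) simp

lemma spectral_norm_nonneg: "0 \<le> spectral_norm A"
  unfolding spectral_norm_def by (rule onorm_pos_le) simp

subsection \<open>Descent over one cycle\<close>

text \<open>The problem data without any iterates, so that descent can be shown for one cycle from
  an arbitrary feasible point. Continuity of \<open>g i\<close> on its compact domain serves the
  existence of the extrema.\<close>

locale cbcg_problem =
  fixes b :: "'d::finite \<Rightarrow> nat" and N :: nat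
    and A :: "real ^ 'd ^ 'm"
    and F :: "real ^ 'm \<Rightarrow> real"
    and g :: "nat \<Rightarrow> real ^ 'd \<Rightarrow> ereal"
    and \<beta> :: "nat \<Rightarrow> real" and LF :: real
  assumes blocks: "range b = {1..N}"
    and g_proper: "\<And>i. i \<in> {1..N} \<Longrightarrow> proper_fun (blk_space b i) (g i)"
    and g_convex: "\<And>i. i \<in> {1..N} \<Longrightarrow> convex_fun (blk_space b i) (g i)"
    and dom_compact: "\<And>i. i \<in> {1..N} \<Longrightarrow> compact (blk_dom b g i)"
    and g_continuous: "\<And>i. i \<in> {1..N} \<Longrightarrow>
          continuous_on (blk_dom b g i) (\<lambda>z. real_of_ereal (g i z))"
    and F_convex: "convex_on ((\<lambda>z. A *v z) ` prod_dom b N g) F"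
    and F_C1: "C1_over F ((\<lambda>z. A *v z) ` prod_dom b N g)"
    and F_lipschitz: "LF-lipschitz_on ((\<lambda>z. A *v z) ` prod_dom b N g) (grad F)"
    and \<beta>_pos: "\<And>i. i \<in> {1..N} \<Longrightarrow> \<beta> i > 0"
    and \<beta>_bound: "\<And>i z h. i \<in> {1..N} \<Longrightarrow> z \<in> prod_dom b N g \<Longrightarrow> h \<in> blk_space b i \<Longrightarrow>
          z + blk_U b i *v h \<in> prod_dom b N g \<Longrightarrow>
          norm (grad F (A *v z + (A ** blk_U b i) *v h) - grad F (A *v z))
            \<le> \<beta> i * norm ((A ** blk_U b i) *v h)"
begin

abbreviation X where "X \<equiv> prod_dom b N g"
abbreviation P where "P \<equiv> blk_proj b"
abbreviation DB where "DB i \<equiv> diameter (blk_dom b g i)"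
abbreviation AB where "AB i \<equiv> spectral_norm (A ** blk_U b i)"
abbreviation gr where "gr i z \<equiv> real_of_ereal (g i z)"

text \<open>Real-valued counterparts, on \<open>X\<close>, of \<open>g_obj\<close>, of
  \<open>H_obj\<close> and of the expression maximised in \<open>S_meas\<close>. In
  \<open>gap\<close> the gradient of \<open>f\<close> is already expressed through that of
  \<open>F\<close>.\<close>

definition gsum where "gsum z = (\<Sum>i=1..N. gr i (P i z))"
definition Hr where "Hr z = F (A *v z) + gsum z"
definition gap where "gap z q = grad F (A *v z) \<bullet> (A *v (z - q)) + gsum z - gsum q"

section \<open>The feasible set and its product structure\<close>

lemma X_iff: "z \<in> X \<longleftrightarrow> (\<forall>i\<in>{1..N}. P i z \<in> blk_dom b g i)"
  by (simp add: prod_dom_def transpose_blk_U blk_U_mult)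

lemma blk_dom_subset: "blk_dom b g i \<subseteq> blk_space b i"
  by (auto simp: blk_dom_def eff_dom_def)

lemma P_of_blk_dom:
  assumes "z \<in> blk_dom b g j"
  shows "P i z = (if i = j then z else 0)"
  using assms blk_dom_subset by (intro blk_proj_of_blk_space) auto

text \<open>Each projection annihilates the vectors of all other blocks, so feasible points can be
  assembled from independently chosen block components.\<close>

lemma P_sum_blk_dom:
  assumes "\<And>j. j \<in> {1..N} \<Longrightarrow> q j \<in> blk_dom b g j" and "i \<in> {1..N}"
  shows "P i (\<Sum>j=1..N. q j) = q i"
proof -
  have "P i (\<Sum>j=1..N. q j) = (\<Sum>j=1..N. P i (q j))"
    by (rule blk_proj_sum)
  also have "\<dots> = (\<Sum>j=1..N. if j = i then q j else 0)"
    using P_of_blk_dom[OF assms(1)] by (intro sum.cong) auto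
  finally show ?thesis
    using assms(2) by simp
qed

lemma sum_blk_dom_in_X:
  assumes "\<And>j. j \<in> {1..N} \<Longrightarrow> q j \<in> blk_dom b g j"
  shows "(\<Sum>j=1..N. q j) \<in> X"
  unfolding X_iff using P_sum_blk_dom[OF assms] assms by metis

lemma sum_P: "(\<Sum>i=1..N. P i z) = z"
  using blocks by (intro sum_blk_proj) auto

lemma X_nonempty: "X \<noteq> {}"
proof -
  have "\<exists>z. z \<in> blk_dom b g i" if "i \<in> {1..N}" for i
    using g_proper[OF that] by (auto simp: proper_fun_def blk_dom_def)
  then obtain q where "\<And>i. i \<in> {1..N} \<Longrightarrow> q i \<in> blk_dom b g i"
    by metis
  then show ?thesis
    using sum_blk_dom_in_X by blast
qed

lemma g_eq_gr:
  assumes "i \<in> {1..N}" and "z \<in> blk_dom b g i"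
  shows "g i z = ereal (gr i z)"
proof -
  have "\<bar>g i z\<bar> \<noteq> \<infinity>"
    using g_proper[OF assms(1)] assms(2) by (auto simp: proper_fun_def blk_dom_def eff_dom_def)
  then show ?thesis
    by (simp add: ereal_real')
qed

lemma
  assumes i: "i \<in> {1..N}" and z: "z \<in> blk_dom b g i" and w: "w \<in> blk_dom b g i"
    and t: "0 \<le> t" "t \<le> 1"
  shows blk_dom_convex: "(1 - t) *\<^sub>R z + t *\<^sub>R w \<in> blk_dom b g i"
    and gr_convex: "gr i ((1 - t) *\<^sub>R z + t *\<^sub>R w) \<le> (1 - t) * gr i z + t * gr i w"
proof -
  let ?u = "(1 - t) *\<^sub>R z + t *\<^sub>R w" and ?s = "(1 - t) * gr i z + t * gr i w"
  \<comment> \<open>One convex combination of two graph points in the epigraph gives both claims: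
    its finite height puts the base point in the domain and bounds the value there.\<close>
  have "(v, gr i v) \<in> ereal_epigraph (blk_space b i) (g i)" if "v \<in> blk_dom b g i" for v
    using g_eq_gr[OF i that] blk_dom_subset that by (auto simp: ereal_epigraph_def)
  then have "(1 - t) *\<^sub>R (z, gr i z) + t *\<^sub>R (w, gr i w) \<in> ereal_epigraph (blk_space b i) (g i)"
    using g_convex[OF i] z w t unfolding convex_fun_def by (intro convexD) auto
  then have u: "?u \<in> blk_space b i" "g i ?u \<le> ereal ?s"
    by (auto simp: ereal_epigraph_def)
  then show dom: "?u \<in> blk_dom b g i"
    by (auto simp: blk_dom_def eff_dom_def less_ereal.simps(4)[of ?s] intro: le_less_trans)
  show "gr i ?u \<le> ?s"
    using u(2) by (metis g_eq_gr[OF i dom] ereal_less_eq(3))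
qed

lemma X_convex:
  assumes "z \<in> X" "w \<in> X" "0 \<le> t" "t \<le> 1"
  shows "(1 - t) *\<^sub>R z + t *\<^sub>R w \<in> X"
  using assms by (simp add: X_iff blk_proj_add blk_proj_scaleR blk_dom_convex)

lemma continuous_P: "continuous_on S (P i)"
  by (rule linear_continuous_on) (rule linear_conv_bounded_linear[THEN iffD1, OF linear_blk_proj])

text \<open>Finitely many bounded blocks add up to a bounded set, and \<open>X\<close> is closed as
  an intersection of preimages of closed sets under the projections.\<close>

lemma X_compact: "compact X"
proof -
  have "\<exists>M. \<forall>w\<in>blk_dom b g i. norm w \<le> M" if "i \<in> {1..N}" for i
    using compact_imp_bounded[OF dom_compact[OF that]] by (auto simp: bounded_iff)
  then obtain M where M: "\<And>i w. i \<in> {1..N} \<Longrightarrow> w \<in> blk_dom b g i \<Longrightarrow> norm w \<le> M i"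
    by metis
  have "norm z \<le> (\<Sum>i=1..N. M i)" if "z \<in> X" for z
  proof -
    have "norm (\<Sum>i=1..N. P i z) \<le> (\<Sum>i=1..N. M i)"
      using M that by (intro sum_norm_le) (auto simp: X_iff)
    then show ?thesis
      by (simp only: sum_P)
  qed
  then have "bounded X"
    by (auto simp: bounded_iff)
  moreover have "closed X"
  proof -
    have "X = (\<Inter>i\<in>{1..N}. P i -` blk_dom b g i)"
      by (auto simp: X_iff)
    moreover have "closed (P i -` blk_dom b g i)" if "i \<in> {1..N}" for i
      using compact_imp_closed[OF dom_compact[OF that]] continuous_P by (intro closed_vimage)
    ultimately show ?thesis
      by auto
  qed
  ultimately show ?thesis
    by (simp add: compact_eq_bounded_closed)
qed

section \<open>Continuity and gradients on the feasible set\<close>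

lemma continuous_gsum: "continuous_on X gsum"
  unfolding gsum_def
proof (rule continuous_on_sum)
  fix i assume i: "i \<in> {1..N}"
  show "continuous_on X (\<lambda>z. gr i (P i z))"
    by (rule continuous_on_compose2[OF g_continuous[OF i] continuous_P]) (use i in \<open>auto simp: X_iff\<close>)
qed

lemma GDERIV_F:
  assumes "z \<in> X"
  shows "GDERIV F (A *v z) :> grad F (A *v z)"
proof -
  obtain D where D: "GDERIV F (A *v z) :> D"
    using F_C1 assms by (auto simp: C1_over_def)
  then show ?thesis
    by (simp add: grad_eq)
qed

lemma grad_f:
  assumes "z \<in> X"
  shows "grad (f_obj A F) z = transpose A *v grad F (A *v z)"
  unfolding f_obj_def[abs_def] by (intro grad_eq GDERIV_matrix_compose GDERIV_F assms)

lemma inner_grad_f: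
  assumes "z \<in> X"
  shows "grad (f_obj A F) z \<bullet> v = grad F (A *v z) \<bullet> (A *v v)"
  by (simp add: grad_f[OF assms] transpose_matrix_vector dot_lmul_matrix)

lemma continuous_Hr: "continuous_on X Hr"
proof -
  have "isCont (\<lambda>z. F (A *v z)) z" if "z \<in> X" for z
    using GDERIV_matrix_compose[OF GDERIV_F[OF that]]
    by (auto simp: gderiv_def intro: has_derivative_continuous)
  then show ?thesis
    unfolding Hr_def[abs_def]
    by (intro continuous_on_add continuous_gsum continuous_at_imp_continuous_on) auto
qed

section \<open>Extended-real values and attained extrema\<close>

lemma g_obj_eq:
  assumes "z \<in> X"
  shows "g_obj b N g z = ereal (gsum z)"
proof -
  have "g_obj b N g z = (\<Sum>i=1..N. ereal (gr i (P i z)))"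
    unfolding g_obj_def
    by (rule sum.cong)
      (use assms in \<open>auto simp: transpose_blk_U blk_U_mult X_iff intro!: g_eq_gr\<close>)
  then show ?thesis
    by (simp add: gsum_def)
qed

lemma H_obj_eq:
  assumes "z \<in> X"
  shows "H_obj b N A F g z = ereal (Hr z)"
  using assms by (simp add: H_obj_def Hr_def f_obj_def g_obj_eq)

text \<open>Turns the minimum over the whole space in \<open>H_min\<close> into a minimum over
  \<open>X\<close>.\<close>

lemma H_obj_outside:
  assumes "z \<notin> X"
  shows "H_obj b N A F g z = \<infinity>"
proof -
  have "\<exists>i\<in>{1..N}. g i (P i z) = \<infinity>"
    using assms by (auto simp: X_iff blk_dom_def eff_dom_def)
  then have "g_obj b N g z = \<infinity>"
    by (auto simp: g_obj_def sum_Pinfty transpose_blk_U blk_U_mult)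
  then show ?thesis
    by (simp add: H_obj_def)
qed

text \<open>\<open>LEAST\<close> carries information only once a minimiser is exhibited; the extreme
  value theorem on the compact set \<open>X\<close> supplies one.\<close>

lemma H_min_attained: "\<exists>z\<in>X. H_min b N A F g = ereal (Hr z) \<and> (\<forall>w\<in>X. Hr z \<le> Hr w)"
proof -
  obtain z where z: "z \<in> X" "\<And>w. w \<in> X \<Longrightarrow> Hr z \<le> Hr w"
    using continuous_attains_inf[OF X_compact X_nonempty continuous_Hr] by auto
  have "H_min b N A F g = H_obj b N A F g z"
    unfolding H_min_def
  proof (rule Least_equality)
    fix v assume "v \<in> range (H_obj b N A F g)"
    then obtain w where w: "v = H_obj b N A F g w"
      by auto
    show "H_obj b N A F g z \<le> v"
      by (cases "w \<in> X") (use z in \<open>simp_all add: w H_obj_eq H_obj_outside\<close>)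
  qed simp
  then show ?thesis
    using z by (auto simp: H_obj_eq)
qed

lemma S_meas_attained:
  assumes z: "z \<in> X"
  shows "\<exists>q\<in>X. S_meas b N A F g z = ereal (gap z q) \<and> (\<forall>w\<in>X. gap z w \<le> gap z q)"
proof -
  have val: "ereal (grad (f_obj A F) z \<bullet> (z - w)) + g_obj b N g z - g_obj b N g w = ereal (gap z w)"
    if "w \<in> X" for w
    using z that by (simp add: g_obj_eq gap_def inner_grad_f)
  have "continuous_on X (gap z)"
    unfolding gap_def[abs_def]
    by (intro continuous_intros continuous_gsum linear_continuous_on_compose[OF _ matrix_vector_mul_linear])
  then obtain q where q: "q \<in> X" "\<And>w. w \<in> X \<Longrightarrow> gap z w \<le> gap z q"
    using continuous_attains_sup[OF X_compact X_nonempty] by blast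
  have "S_meas b N A F g z = ereal (gap z q)"
    unfolding S_meas_def
    by (rule Greatest_equality) (use q val in \<open>auto intro!: bexI[of _ q]\<close>)
  then show ?thesis
    using q by blast
qed

text \<open>The tangent inequality for \<open>F\<close> between the images of the two points; the
  \<open>gsum\<close> terms are the same on both sides. With \<open>w\<close> a minimiser it shows
  that \<open>S\<close> dominates the optimality gap.\<close>

lemma gap_ge:
  assumes "z \<in> X" "w \<in> X"
  shows "Hr z - Hr w \<le> gap z w"
proof -
  have "F (A *v z) + (A *v w - A *v z) \<bullet> grad F (A *v z) \<le> F (A *v w)"
    using assms by (intro convex_on_above_tangent[OF F_convex _ _ GDERIV_F]) auto
  then show ?thesis
    by (simp add: Hr_def gap_def matrix_vector_mult_diff_distrib inner_diff_left inner_diff_right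
        inner_commute)
qed

section \<open>Descent for one block step and for a whole cycle\<close>

lemma A_P_bound:
  assumes "u \<in> blk_dom b g i" "w \<in> blk_dom b g i" "i \<in> {1..N}"
  shows "norm (A *v (u - w)) \<le> AB i * DB i"
proof -
  \<comment> \<open>The difference lies in block \<open>i\<close>, so \<open>A\<close> acts on it as
    \<open>A ** blk_U b i\<close>, and the norm of the block submatrix can replace that of
    \<open>A\<close>.\<close>
  have "A *v (u - w) = (A ** blk_U b i) *v (u - w)"
    using assms P_of_blk_dom[of _ i i]
    by (simp add: blk_U_mult blk_proj_diff flip: matrix_vector_mul_assoc)
  also have "norm \<dots> \<le> AB i * norm (u - w)"
    by (rule spectral_norm_bound)
  also have "\<dots> \<le> AB i * DB i"
    using diameter_bounded_bound[OF compact_imp_bounded[OF dom_compact[OF assms(3)]] assms(1,2)]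
    by (intro mult_left_mono spectral_norm_nonneg) (simp add: dist_norm)
  finally show ?thesis .
qed

text \<open>The segment towards \<open>q\<close> stays in \<open>X\<close> by convexity of the block
  domain and moves only block \<open>i\<close>, so the descent inequality for \<open>F\<close> holds
  with constant \<open>\<beta> i\<close>; convexity of \<open>g i\<close> controls the only summand
  of \<open>gsum\<close> that changes.\<close>

lemma block_descent:
  assumes i: "i \<in> {1..N}" and z: "z \<in> X" and q: "q \<in> blk_dom b g i" and a: "0 \<le> a" "a \<le> 1"
  shows "Hr (z + a *\<^sub>R (q - P i z)) \<le> Hr z
      + a * (grad F (A *v z) \<bullet> (A *v (q - P i z)) + gr i q - gr i (P i z))
      + a\<^sup>2 / 2 * (\<beta> i * (AB i)\<^sup>2 * (DB i)\<^sup>2)"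
proof -
  define d where "d = q - P i z"
  have Pd: "P i d = d"
    using q by (simp add: d_def blk_proj_diff blk_proj_blk_proj P_of_blk_dom)
  have Pj: "P j (z + s *\<^sub>R d) = (if j = i then (1 - s) *\<^sub>R P i z + s *\<^sub>R q else P j z)" for s j
    using q by (simp add: d_def blk_proj_add blk_proj_diff blk_proj_scaleR blk_proj_blk_proj
        P_of_blk_dom algebra_simps)
  have inX: "z + s *\<^sub>R d \<in> X" if "0 \<le> s" "s \<le> 1" for s
    using z q i that by (auto simp: X_iff Pj blk_dom_convex)
  let ?v = "A *v (a *\<^sub>R d)"
  have "F (A *v z + ?v) \<le> F (A *v z) + ?v \<bullet> grad F (A *v z) + \<beta> i / 2 * (norm ?v)\<^sup>2"
  proof -
    have eq: "A *v z + t *\<^sub>R ?v = A *v (z + (t * a) *\<^sub>R d)" for t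
      by (simp add: matrix_vector_right_distrib matrix_vector_mult_scaleR)
    have AU: "(A ** blk_U b i) *v (s *\<^sub>R d) = A *v (s *\<^sub>R d)" for s
      by (simp add: blk_U_mult blk_proj_scaleR Pd flip: matrix_vector_mul_assoc)
    have ta: "0 \<le> t * a \<and> t * a \<le> 1" if "0 \<le> t" "t \<le> 1" for t
      using a that by (auto intro: mult_le_one)
    \<comment> \<open>The zero multiple is kept so that the gradient along the segment is one
      function of \<open>t\<close>, evaluated here at 0.\<close>
    have "F (A *v z + ?v) \<le> F (A *v z) + ?v \<bullet> grad F (A *v z + 0 *\<^sub>R ?v) + \<beta> i / 2 * (norm ?v)\<^sup>2"
    proof (rule descent_along_segment)
      fix t :: real assume t: "0 \<le> t" "t \<le> 1"
      show "GDERIV F (A *v z + t *\<^sub>R ?v) :> grad F (A *v z + t *\<^sub>R ?v)"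
        unfolding eq using ta[OF t] by (intro GDERIV_F inX) auto
      have "norm (grad F (A *v z + (A ** blk_U b i) *v ((t * a) *\<^sub>R d)) - grad F (A *v z))
          \<le> \<beta> i * norm ((A ** blk_U b i) *v ((t * a) *\<^sub>R d))"
      proof (rule \<beta>_bound[OF i z])
        have "(t * a) *\<^sub>R d = P i ((t * a) *\<^sub>R d)"
          by (simp add: blk_proj_scaleR Pd)
        then show "(t * a) *\<^sub>R d \<in> blk_space b i"
          by (metis blk_proj_in_blk_space)
        show "z + blk_U b i *v (t * a) *\<^sub>R d \<in> X"
          using inX ta[OF t] by (simp add: blk_U_mult blk_proj_scaleR Pd)
      qed
      then show "norm (grad F (A *v z + t *\<^sub>R ?v) - grad F (A *v z + 0 *\<^sub>R ?v)) \<le> \<beta> i * (t * norm ?v)"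
        unfolding AU using t
        by (simp add: matrix_vector_mult_scaleR abs_mult)
    qed
    then show ?thesis
      by simp
  qed
  also have "?v \<bullet> grad F (A *v z) = a * (grad F (A *v z) \<bullet> (A *v d))"
    by (simp add: matrix_vector_mult_scaleR inner_commute)
  also have "\<beta> i / 2 * (norm ?v)\<^sup>2 \<le> a\<^sup>2 / 2 * (\<beta> i * (AB i)\<^sup>2 * (DB i)\<^sup>2)"
  proof -
    have "norm (A *v d) \<le> AB i * DB i"
      unfolding d_def using q z i by (intro A_P_bound) (auto simp: X_iff)
    then have "(norm (A *v d))\<^sup>2 \<le> (AB i * DB i)\<^sup>2"
      by (rule power_mono) simp
    then have "\<beta> i / 2 * a\<^sup>2 * (norm (A *v d))\<^sup>2 \<le> \<beta> i / 2 * a\<^sup>2 * (AB i * DB i)\<^sup>2"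
      using \<beta>_pos[OF i] by (intro mult_left_mono) auto
    then show ?thesis
      by (simp add: matrix_vector_mult_scaleR power_mult_distrib mult_ac)
  qed
  finally have Fpart: "F (A *v (z + a *\<^sub>R d)) \<le> F (A *v z) + a * (grad F (A *v z) \<bullet> (A *v d))
      + a\<^sup>2 / 2 * (\<beta> i * (AB i)\<^sup>2 * (DB i)\<^sup>2)"
    by (simp add: matrix_vector_right_distrib)
  have "gsum (z + a *\<^sub>R d) - gsum z = (\<Sum>j=1..N. gr j (P j (z + a *\<^sub>R d)) - gr j (P j z))"
    by (simp add: gsum_def sum_subtractf)
  also have "\<dots> = (\<Sum>j=1..N. if j = i then gr i ((1 - a) *\<^sub>R P i z + a *\<^sub>R q) - gr i (P i z) else 0)"
    by (intro sum.cong) (auto simp: Pj)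
  also have "\<dots> = gr i ((1 - a) *\<^sub>R P i z + a *\<^sub>R q) - gr i (P i z)"
    using i by simp
  also have "\<dots> \<le> a * (gr i q - gr i (P i z))"
    using gr_convex[OF i, of "P i z" q a] z q a i by (auto simp: X_iff algebra_simps)
  finally show ?thesis
    using Fpart by (simp add: Hr_def d_def algebra_simps)
qed

text \<open>\<open>w\<close> is an arbitrary comparison point, later chosen to maximise the gap.
  \<open>p_min\<close> is conditional on feasibility of the inner iterate because the gradient of
  \<open>f\<close> is expressed through \<open>grad F\<close> only on \<open>X\<close>; feasibility
  is established in the proof.\<close>

lemma cycle_descent:
  assumes z: "z \<in> X" and w: "w \<in> X" and a: "0 \<le> a" "a \<le> 1"
    and y0: "y 0 = z"
    and p_dom: "\<And>i. i \<in> {1..N} \<Longrightarrow> p i \<in> blk_dom b g i"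
    and p_min: "\<And>i q. i \<in> {1..N} \<Longrightarrow> y (i - 1) \<in> X \<Longrightarrow> q \<in> blk_dom b g i \<Longrightarrow>
      grad F (A *v y (i - 1)) \<bullet> (A *v p i) + gr i (p i) \<le> grad F (A *v y (i - 1)) \<bullet> (A *v q) + gr i q"
    and y_step: "\<And>i. i \<in> {1..N} \<Longrightarrow> y i = y (i - 1) + a *\<^sub>R (p i - P i (y (i - 1)))"
  shows "y N \<in> X"
    and "Hr (y N) \<le> Hr z - a * gap z w + a\<^sup>2 * (C1_const b N A g LF \<beta> / 2)"
proof -
  \<comment> \<open>Each block is visited once, so the inner iterates are \<open>(1 - a) z + a (v i)\<close> with \<open>v i\<close> in the
    domain; hence they stay in the domain, at distance at most \<open>a\<close> times its diameter from \<open>z\<close>.\<close>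
  define v where "v i = (\<Sum>j=1..N. if j \<le> i then p j else P j z)" for i
  have v_dom: "(if j \<le> i then p j else P j z) \<in> blk_dom b g j" if "j \<in> {1..N}" for i j
    using that p_dom z by (auto simp: X_iff)
  have vX: "v i \<in> X" for i
    unfolding v_def using v_dom by (intro sum_blk_dom_in_X) auto
  have Pv: "P j (v i) = (if j \<le> i then p j else P j z)" if "j \<in> {1..N}" for i j
    unfolding v_def using v_dom that by (intro P_sum_blk_dom) auto
  have y_eq: "y i = z + a *\<^sub>R (v i - z)" if "i \<le> N" for i
    using that
  proof (induction i)
    case 0
    have "v 0 = (\<Sum>j=1..N. P j z)"
      unfolding v_def by (rule sum.cong) auto
    then have "v 0 = z"
      by (simp only: sum_P)
    then show ?case
      by (simp add: y0)
  next
    case (Suc i)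
    have "v (Suc i) - v i = (\<Sum>j=1..N. if j = Suc i then p j - P j z else 0)"
      unfolding v_def sum_subtractf[symmetric] by (rule sum.cong) auto
    then have v_Suc: "v (Suc i) = v i + (p (Suc i) - P (Suc i) z)"
      using Suc.prems by (simp add: algebra_simps)
    \<comment> \<open>Block \<open>Suc i\<close> has not been visited yet, so it still agrees with
      that of \<open>z\<close>.\<close>
    have "P (Suc i) (y i) = P (Suc i) z"
      using Suc Pv[of "Suc i" i] by (simp add: blk_proj_add blk_proj_diff blk_proj_scaleR)
    then have "y (Suc i) = y i + a *\<^sub>R (p (Suc i) - P (Suc i) z)"
      using y_step[of "Suc i"] Suc.prems by simp
    also have "y i = z + a *\<^sub>R (v i - z)"
      using Suc by simp
    finally show ?case
      by (simp add: v_Suc algebra_simps)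
  qed
  have yX: "y i \<in> X" if "i \<le> N" for i
  proof -
    have "y i = (1 - a) *\<^sub>R z + a *\<^sub>R v i"
      using y_eq[OF that] by (simp add: algebra_simps)
    then show ?thesis
      using X_convex[OF z vX a] by simp
  qed
  then show "y N \<in> X"
    by simp
  have Py: "P i (y (i - 1)) = P i z" if "i \<in> {1..N}" for i
    using y_eq[of "i - 1"] Pv[OF that, of "i - 1"] that
    by (auto simp: blk_proj_add blk_proj_diff blk_proj_scaleR)
  \<comment> \<open>\<open>e i\<close> is the share of block \<open>i\<close> in
    \<open>- gap z w\<close>. \<open>R i\<close> collects its second-order costs: the curvature term
    of the block step and the price of replacing the gradient at the inner iterate by that at
    \<open>z\<close>.\<close>
  define e where "e i = grad F (A *v z) \<bullet> (A *v (P i w - P i z)) + gr i (P i w) - gr i (P i z)" for i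
  define R where "R i = \<beta> i * (AB i)\<^sup>2 * (DB i)\<^sup>2 / 2
      + LF * diameter X * spectral_norm A * (DB i * AB i)" for i
  have step: "Hr (y i) - Hr (y (i - 1)) \<le> a * e i + a\<^sup>2 * R i" if i: "i \<in> {1..N}" for i
  proof -
    let ?y = "y (i - 1)"
    have y: "?y \<in> X" and Pw: "P i w \<in> blk_dom b g i" and Pz: "P i z \<in> blk_dom b g i"
      using i yX w z by (auto simp: X_iff)
    have "Hr (y i) \<le> Hr ?y
      + a * (grad F (A *v ?y) \<bullet> (A *v (p i - P i z)) + gr i (p i) - gr i (P i z))
      + a\<^sup>2 / 2 * (\<beta> i * (AB i)\<^sup>2 * (DB i)\<^sup>2)"
      using block_descent[OF i y p_dom[OF i] a]
      by (simp only: y_step[OF i] Py[OF i])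
    moreover have "grad F (A *v ?y) \<bullet> (A *v (p i - P i z)) + gr i (p i) - gr i (P i z)
        \<le> e i + a * (LF * diameter X * spectral_norm A * (DB i * AB i))"
    proof -
      have "grad F (A *v ?y) \<bullet> (A *v (p i - P i z)) + gr i (p i)
          \<le> grad F (A *v ?y) \<bullet> (A *v (P i w - P i z)) + gr i (P i w)"
        using p_min[OF i y Pw] by (simp add: matrix_vector_mult_diff_distrib inner_diff_right)
      \<comment> \<open>Minimality has replaced \<open>p i\<close> by the block of \<open>w\<close>;
        now the gradient is moved from \<open>?y\<close> to \<open>z\<close>. The factor
        \<open>a\<close> comes from the distance between these two points.\<close>
      moreover have "(grad F (A *v ?y) - grad F (A *v z)) \<bullet> (A *v (P i w - P i z))
          \<le> a * (LF * diameter X * spectral_norm A * (DB i * AB i))"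
      proof -
        have LF: "0 \<le> LF"
          using F_lipschitz by (rule lipschitz_on_nonneg)
        have "norm (?y - z) \<le> a * diameter X"
        proof -
          have "dist (v (i - 1)) z \<le> diameter X"
            by (rule diameter_bounded_bound[OF compact_imp_bounded[OF X_compact] vX z])
          then show ?thesis
            using a i y_eq[of "i - 1"] by (auto simp: dist_norm intro!: mult_left_mono)
        qed
        then have "norm (A *v (?y - z)) \<le> spectral_norm A * (a * diameter X)"
          by (meson spectral_norm_bound spectral_norm_nonneg mult_left_mono order_trans)
        moreover have "norm (grad F (A *v ?y) - grad F (A *v z)) \<le> LF * norm (A *v (?y - z))"
          using lipschitz_onD[OF F_lipschitz, of "A *v ?y" "A *v z"] y z
          by (simp add: dist_norm matrix_vector_mult_diff_distrib)
        ultimately have "norm (grad F (A *v ?y) - grad F (A *v z))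
            \<le> LF * (spectral_norm A * (a * diameter X))"
          using LF by (meson mult_left_mono order_trans)
        moreover have "norm (A *v (P i w - P i z)) \<le> AB i * DB i"
          by (rule A_P_bound[OF Pw Pz i])
        ultimately have "norm (grad F (A *v ?y) - grad F (A *v z)) * norm (A *v (P i w - P i z))
            \<le> LF * (spectral_norm A * (a * diameter X)) * (AB i * DB i)"
          by (intro mult_mono) (auto intro: order_trans[OF norm_ge_zero])
        then show ?thesis
          by (intro order_trans[OF norm_cauchy_schwarz]) (simp add: mult_ac)
      qed
      ultimately show ?thesis
        by (simp add: e_def inner_diff_left)
    qed
    then have "a * (grad F (A *v ?y) \<bullet> (A *v (p i - P i z)) + gr i (p i) - gr i (P i z))
        \<le> a * (e i + a * (LF * diameter X * spectral_norm A * (DB i * AB i)))"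
      using a(1) by (rule mult_left_mono)
    ultimately show ?thesis
      by (simp add: R_def power2_eq_square algebra_simps)
  qed
  have "Hr (y N) - Hr z = (\<Sum>i=1..N. Hr (y i) - Hr (y (i - 1)))"
    using sum_telescope''[of 0 N "\<lambda>i. Hr (y i)"] y0 by (simp add: atLeastSucAtMost_greaterThanAtMost)
  also have "\<dots> \<le> (\<Sum>i=1..N. a * e i + a\<^sup>2 * R i)"
    by (rule sum_mono) (rule step)
  also have "\<dots> = a * (\<Sum>i=1..N. e i) + a\<^sup>2 * (\<Sum>i=1..N. R i)"
    by (simp add: sum.distrib sum_distrib_left)
  \<comment> \<open>All \<open>e i\<close> use the gradient at the same point \<open>z\<close>, so
    the block displacements add up to \<open>w - z\<close>.\<close>
  also have "(\<Sum>i=1..N. e i) = - gap z w"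
  proof -
    have "(\<Sum>i=1..N. A *v (P i w - P i z)) = A *v (\<Sum>i=1..N. P i w - P i z)"
      by (rule linear_sum[OF matrix_vector_mul_linear, symmetric])
    also have "\<dots> = A *v (w - z)"
      by (simp only: sum_subtractf sum_P)
    finally have "(\<Sum>i=1..N. e i) = grad F (A *v z) \<bullet> (A *v (w - z)) + gsum w - gsum z"
      by (simp add: e_def gsum_def sum.distrib sum_subtractf flip: inner_sum_right)
    then show ?thesis
      by (simp add: gap_def matrix_vector_mult_diff_distrib inner_diff_right)
  qed
  also have "(\<Sum>i=1..N. R i) = C1_const b N A g LF \<beta> / 2"
    by (simp add: R_def C1_const_def sum.distrib sum_distrib_left sum_divide_distrib add_divide_distrib
        mult.assoc)
  finally show "Hr (y N) \<le> Hr z - a * gap z w + a\<^sup>2 * (C1_const b N A g LF \<beta> / 2)"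
    by simp
qed

section \<open>Application to the CBCG iterates\<close>

lemma C1_const_nonneg: "0 \<le> C1_const b N A g LF \<beta>"
proof -
  have "0 \<le> DB i" if "i \<in> {1..N}" for i
    using that by (intro diameter_ge_0 compact_imp_bounded dom_compact)
  moreover have "0 \<le> diameter X"
    by (intro diameter_ge_0 compact_imp_bounded X_compact)
  moreover have "0 \<le> LF"
    using F_lipschitz by (rule lipschitz_on_nonneg)
  moreover have "0 \<le> \<beta> i" if "i \<in> {1..N}" for i
    using \<beta>_pos[OF that] by simp
  ultimately show ?thesis
    unfolding C1_const_def
    by (intro add_nonneg_nonneg mult_nonneg_nonneg sum_nonneg spectral_norm_nonneg) auto
qed

text \<open>Translates the extended-real argmin and the padded block updates of the method into the
  real-valued hypotheses of \<open>cycle_descent\<close>.\<close>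

lemma CBCG_step:
  assumes cbcg: "CBCG b N A F g \<alpha> x y p"
    and stepsize: "\<And>i. i \<in> {1..N} \<Longrightarrow> \<alpha> k i = a" and a: "0 \<le> a" "a \<le> 1"
    and xk: "x k \<in> X" and w: "w \<in> X"
  shows "x (Suc k) \<in> X"
    and "Hr (x (Suc k)) \<le> Hr (x k) - a * gap (x k) w + a\<^sup>2 * (C1_const b N A g LF \<beta> / 2)"
proof -
  have y0: "y k 0 = x k" and yN: "x (Suc k) = y k N"
    using cbcg by (auto simp: CBCG_def)
  have argmin: "is_arg_min (\<lambda>q. ereal (grad_blk b A F i (y k (i - 1)) \<bullet> q) + g i q)
      (\<lambda>q. q \<in> blk_dom b g i) (p k i)" if "i \<in> {1..N}" for i
    using cbcg that by (auto simp: CBCG_def)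
  have p_dom: "p k i \<in> blk_dom b g i" if "i \<in> {1..N}" for i
    using argmin[OF that] by (simp add: is_arg_min_def)
  have p_min: "grad F (A *v y k (i - 1)) \<bullet> (A *v p k i) + gr i (p k i)
      \<le> grad F (A *v y k (i - 1)) \<bullet> (A *v q) + gr i q"
    if i: "i \<in> {1..N}" and y: "y k (i - 1) \<in> X" and q: "q \<in> blk_dom b g i" for i q
  proof -
    \<comment> \<open>On vectors of block \<open>i\<close> the partial gradient and the full
      gradient have the same inner product, and \<open>g i\<close> is finite there.\<close>
    have val: "ereal (grad_blk b A F i (y k (i - 1)) \<bullet> r) + g i r
        = ereal (grad F (A *v y k (i - 1)) \<bullet> (A *v r) + gr i r)" if "r \<in> blk_dom b g i" for r
    proof -
      have "grad_blk b A F i (y k (i - 1)) \<bullet> r = grad F (A *v y k (i - 1)) \<bullet> (A *v r)"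
        using y P_of_blk_dom[OF that, of i]
        by (simp add: grad_blk_def transpose_blk_U blk_U_mult blk_proj_inner inner_grad_f)
      then show ?thesis
        by (metis g_eq_gr[OF i that] plus_ereal.simps(1))
    qed
    show ?thesis
    proof -
      have "ereal (grad_blk b A F i (y k (i - 1)) \<bullet> p k i) + g i (p k i)
          \<le> ereal (grad_blk b A F i (y k (i - 1)) \<bullet> q) + g i q"
        using argmin[OF i] q by (auto simp: is_arg_min_def not_less)
      then show ?thesis
        unfolding val[OF p_dom[OF i]] val[OF q] by (simp only: ereal_less_eq)
    qed
  qed
  have y_step: "y k i = y k (i - 1) + a *\<^sub>R (p k i - P i (y k (i - 1)))" if "i \<in> {1..N}" for i
    using cbcg that p_dom[OF that] stepsize[OF that]
    by (simp add: CBCG_def transpose_blk_U blk_U_mult blk_proj_diff blk_proj_blk_proj P_of_blk_dom)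
  show "x (Suc k) \<in> X"
    and "Hr (x (Suc k)) \<le> Hr (x k) - a * gap (x k) w + a\<^sup>2 * (C1_const b N A g LF \<beta> / 2)"
    unfolding yN using cycle_descent[OF xk w a y0 p_dom p_min y_step] by auto
qed

end

theorem theorem4p5:
  fixes b :: "'d::finite \<Rightarrow> nat" and N :: nat
    and A :: "real ^ 'd ^ 'm"
    and F :: "real ^ 'm \<Rightarrow> real"
    and g :: "nat \<Rightarrow> real ^ 'd \<Rightarrow> ereal"
    and l \<beta> :: "nat \<Rightarrow> real" and LF :: real
    and \<alpha> :: "nat \<Rightarrow> nat \<Rightarrow> real"
    and x :: "nat \<Rightarrow> real ^ 'd" and y p :: "nat \<Rightarrow> nat \<Rightarrow> real ^ 'd"
  assumes blocks: "range b = {1..N}"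
    and g_proper: "\<And>i. i \<in> {1..N} \<Longrightarrow> proper_fun (blk_space b i) (g i)"
    and g_closed: "\<And>i. i \<in> {1..N} \<Longrightarrow> closed_fun (blk_space b i) (g i)"
    and g_convex: "\<And>i. i \<in> {1..N} \<Longrightarrow> convex_fun (blk_space b i) (g i)"
    and dom_compact: "\<And>i. i \<in> {1..N} \<Longrightarrow> compact (blk_dom b g i)"
    and g_lipschitz: "\<And>i. i \<in> {1..N} \<Longrightarrow>
          (l i)-lipschitz_on (blk_dom b g i) (\<lambda>z. real_of_ereal (g i z))"
    and F_convex: "convex_on ((\<lambda>z. A *v z) ` prod_dom b N g) F"
    and F_C1: "C1_over F ((\<lambda>z. A *v z) ` prod_dom b N g)"
    and F_lipschitz: "LF-lipschitz_on ((\<lambda>z. A *v z) ` prod_dom b N g) (grad F)"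
    and \<beta>_pos: "\<And>i. i \<in> {1..N} \<Longrightarrow> \<beta> i > 0"
    and \<beta>_bound: "\<And>i z h. i \<in> {1..N} \<Longrightarrow> z \<in> prod_dom b N g \<Longrightarrow> h \<in> blk_space b i \<Longrightarrow>
          z + blk_U b i *v h \<in> prod_dom b N g \<Longrightarrow>
          norm (grad F (A *v z + (A ** blk_U b i) *v h) - grad F (A *v z))
            \<le> \<beta> i * norm ((A ** blk_U b i) *v h)"
    and cbcg: "CBCG b N A F g \<alpha> x y p"
    and stepsize: "\<And>k i. i \<in> {1..N} \<Longrightarrow> \<alpha> k i = 2 / (real k + 2)"
  shows "(\<forall>k\<ge>1. H_obj b N A F g (x k) - H_min b N A F g
             \<le> ereal (2 * C1_const b N A g LF \<beta> / (real k + 1)))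
       \<and> (\<forall>n\<ge>1. (MIN k\<in>{n div 2..n}. S_meas b N A F g (x k))
             \<le> ereal (8 * C1_const b N A g LF \<beta> / real n))"
proof -
  interpret cbcg_problem b N A F g \<beta> LF
    using blocks g_proper g_convex dom_compact lipschitz_on_continuous_on[OF g_lipschitz]
      F_convex F_C1 F_lipschitz \<beta>_pos \<beta>_bound
    by unfold_locales
  define C where "C = C1_const b N A g LF \<beta>"
  have C: "0 \<le> C"
    unfolding C_def by (rule C1_const_nonneg)
  have a: "0 \<le> 2 / (real k + 2)" "2 / (real k + 2) \<le> 1" for k
    by auto
  have xX: "x k \<in> X" for k
  proof (induction k)
    case 0
    show ?case
      using cbcg by (simp add: CBCG_def)
  next
    case (Suc k)
    \<comment> \<open>Feasibility does not depend on the comparison point, so \<open>x k\<close>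
      itself is used.\<close>
    show ?case
      using CBCG_step(1)[OF cbcg stepsize a Suc Suc] .
  qed
  obtain z where z: "z \<in> X" "H_min b N A F g = ereal (Hr z)" "\<And>w. w \<in> X \<Longrightarrow> Hr z \<le> Hr w"
    using H_min_attained by blast
  obtain q where q: "\<And>k. q k \<in> X" "\<And>k. S_meas b N A F g (x k) = ereal (gap (x k) (q k))"
      "\<And>k w. w \<in> X \<Longrightarrow> gap (x k) w \<le> gap (x k) (q k)"
    using S_meas_attained[OF xX] by metis
  define \<delta> where "\<delta> k = Hr (x k) - Hr z" for k
  define S where "S k = gap (x k) (q k)" for k
  \<comment> \<open>The comparison point is the maximiser \<open>q k\<close>, which turns the gap
    into \<open>S k\<close>.\<close>
  have step: "\<delta> (Suc k) \<le> \<delta> k - 2 / (real k + 2) * S k + (2 / (real k + 2))\<^sup>2 * (C / 2)" for k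
    using CBCG_step(2)[OF cbcg stepsize a xX q(1), of k k] by (simp add: \<delta>_def S_def C_def)
  have gap: "\<delta> k \<le> S k" for k
    unfolding \<delta>_def S_def by (rule order_trans[OF gap_ge[OF xX z(1)] q(3)[OF z(1)]])
  have nonneg: "0 \<le> \<delta> k" for k
    unfolding \<delta>_def using z(3)[OF xX] by simp
  show ?thesis
    unfolding C_def[symmetric]
  proof (intro conjI allI impI)
    fix k :: nat assume "1 \<le> k"
    then have "\<delta> k \<le> 2 * C / (real k + 1)"
      by (rule fw_rate_gap[of \<delta> S C k, OF step gap C])
    then show "H_obj b N A F g (x k) - H_min b N A F g \<le> ereal (2 * C / (real k + 1))"
      by (simp add: H_obj_eq[OF xX] z(2) \<delta>_def)
  next
    fix n :: nat assume "1 \<le> n"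
    then obtain k where k: "k \<in> {n div 2..n}" "S k \<le> 8 * C / real n"
      using fw_rate_min_gap[of \<delta> S C n, OF step gap nonneg C] by blast
    have "(MIN k\<in>{n div 2..n}. S_meas b N A F g (x k)) \<le> S_meas b N A F g (x k)"
      by (rule Min_le) (use k in auto)
    also have "\<dots> \<le> ereal (8 * C / real n)"
      using k(2) by (simp add: q(2) S_def)
    finally show "(MIN k\<in>{n div 2..n}. S_meas b N A F g (x k)) \<le> ereal (8 * C / real n)" .
  qed
qed

end
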